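(* Let $a<b$ be real numbers, let $r$ be a positive continuous function on $(a,b)$ and let $p>1$ be an integer. Put $R(a,x)=\int_a^x r(t)\,dt$. Then for all measurable functions $f\ge 0$ on $(a,b)$ such that all integrals below exist and are finite, $$\int_a^b r(x)\left(\int_x^b f(t)\,dt\right)^{p+1}dx\le C\left(\int_a^b (f(x))^{\frac{p(p+1)}{p-1}}\,dx\right)^{\frac{p-1}{p}},$$ where $$C=(p+1)^{\frac1p}(b-a)^p\left(\int_a^b R^p(a,x)\,dx\right)^{\frac1p}.$$
   Context: Standing assumption: all functions are measurable and all the integrals appearing in the inequality and in $C$ (including those defining $R(a,x)$ and $\int_x^b f$ for $x\in(a,b)$) exist and are finite. $R^p(a,x)$ means $(R(a,x))^p$. *)

theory Defs
  imports "HOL-Analysis.Analysis"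
begin

definition R_int :: "(real \<Rightarrow> real) \<Rightarrow> real \<Rightarrow> real \<Rightarrow> real" where
  "R_int r a x = (LINT t:{a<..<x}|lebesgue. r t)"

definition C_const :: "nat \<Rightarrow> (real \<Rightarrow> real) \<Rightarrow> real \<Rightarrow> real \<Rightarrow> real" where
  "C_const p r a b =
     (real p + 1) powr (1 / real p) * (b - a) ^ p *
     (LINT x:{a<..<b}|lebesgue. (R_int r a x) ^ p) powr (1 / real p)"

end

theory Submission
  imports Defs
begin

text \<open>
  Write $F(x) = \int_x^b f$, $R(x) = \int_a^x r$, $s = p(p+1)/(p-1)$ and $G(x) = \int_x^b f^s$. Since
  $F^{p+1}(x) = (p+1) \int_x^b F^p f$, Tonelli turns the left-hand side into
  $(p+1) \int_a^b R F^p f$. Hoelder on $(x,b)$ gives $F \le (b-x)^{1-1/s} G^{1/s}$, and then Hoelder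
  with the weights $1/p$, $p/s$, $1/s$ for the functions $R^p$, $(b-x)^{s-1}$, $G^p f^s$ reduces the
  claim to $\int_a^b (b-x)^{s-1} = (b-a)^s/s$ and $\int_a^b G^p f^s = G(a)^{p+1}/(p+1)$. The resulting
  constant is at most $C$ because $s \ge p+1$.
\<close>

section \<open>Sigma-finiteness and measurability for the completed Lebesgue measure\<close>

text \<open>A countable cover by sets of finite measure in \<open>M\<close> serves the completion
  too, since sets of \<open>M\<close> keep their measure. As \<open>lebesgue\<close> is the
  completion of \<open>lborel\<close>, this makes Fubini's theorem available for
  \<open>lebesgue\<close>.\<close>

lemma sigma_finite_completion:
  assumes "sigma_finite_measure M"
  shows "sigma_finite_measure (completion M)"
proof -
  obtain A where A: "countable A" "A \<subseteq> sets M" "\<Union>A = space M" "\<forall>a\<in>A. emeasure M a \<noteq> \<infinity>"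
    using sigma_finite_measure.sigma_finite_countable[OF assms] by blast
  show ?thesis
    by standard (use A in \<open>auto intro!: exI[of _ A]\<close>)
qed

interpretation lebesgue: sigma_finite_measure lebesgue
  by (rule sigma_finite_completion) (rule sigma_finite_lborel)

interpretation lebesgue_pair: pair_sigma_finite lebesgue lebesgue ..

lemma ident_measurable_lebesgue [measurable]: "(\<lambda>x. x) \<in> lebesgue \<rightarrow>\<^sub>M borel"
  by (rule measurable_completion) simp

text \<open>Supplies the joint measurability of the indicator of t > x for the Tonelli arguments.
  The projections take values in \<open>lebesgue\<close>, so each is composed with the identity into
  \<open>borel\<close> before the two are compared.\<close>

lemma pred_pair_lebesgue_interval [measurable]:
  "Measurable.pred (lebesgue \<Otimes>\<^sub>M lebesgue) (\<lambda>z::real \<times> real. snd z \<in> {fst z<..})"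
  "Measurable.pred (lebesgue \<Otimes>\<^sub>M lebesgue) (\<lambda>z::real \<times> real. snd z \<in> {..<fst z})"
  using borel_measurable_pred_less[of fst "lebesgue \<Otimes>\<^sub>M lebesgue" snd]
    borel_measurable_pred_less[of snd "lebesgue \<Otimes>\<^sub>M lebesgue" fst]
    measurable_compose[OF measurable_fst ident_measurable_lebesgue]
    measurable_compose[OF measurable_snd ident_measurable_lebesgue]
  by simp_all

section \<open>Tail integrals: Tonelli over a half-plane and the power rule\<close>

lemma borel_measurable_tail_integral [measurable]:
  fixes g :: "real \<Rightarrow> ennreal"
  assumes [measurable]: "g \<in> borel_measurable lebesgue"
  shows "(\<lambda>x. \<integral>\<^sup>+t\<in>{x<..}. g t \<partial>lebesgue) \<in> borel_measurable lebesgue"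
  by measurable

text \<open>Both sides integrate h(x) g(t) over the half-plane x < t. This takes the place of
  integration by parts, and with values in \<open>ennreal\<close> it requires only
  measurability.\<close>

lemma Tonelli_tail:
  fixes h g :: "real \<Rightarrow> ennreal"
  assumes [measurable]: "h \<in> borel_measurable lebesgue" "g \<in> borel_measurable lebesgue"
  shows "(\<integral>\<^sup>+x. h x * (\<integral>\<^sup>+t\<in>{x<..}. g t \<partial>lebesgue) \<partial>lebesgue) =
         (\<integral>\<^sup>+t. (\<integral>\<^sup>+x\<in>{..<t}. h x \<partial>lebesgue) * g t \<partial>lebesgue)"
proof -
  have "(\<integral>\<^sup>+x. h x * (\<integral>\<^sup>+t\<in>{x<..}. g t \<partial>lebesgue) \<partial>lebesgue) =
        (\<integral>\<^sup>+x. (\<integral>\<^sup>+t. h x * g t * indicator {x<..} t \<partial>lebesgue) \<partial>lebesgue)"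
    by (simp add: nn_integral_cmult[symmetric] mult.assoc)
  also have "\<dots> = (\<integral>\<^sup>+t. (\<integral>\<^sup>+x. h x * g t * indicator {x<..} t \<partial>lebesgue) \<partial>lebesgue)"
    by (rule lebesgue_pair.Fubini'[symmetric]) measurable
  also have "\<dots> = (\<integral>\<^sup>+t. (\<integral>\<^sup>+x. h x * indicator {..<t} x * g t \<partial>lebesgue) \<partial>lebesgue)"
    by (intro nn_integral_cong) (auto simp: indicator_def)
  also have "\<dots> = (\<integral>\<^sup>+t. (\<integral>\<^sup>+x\<in>{..<t}. h x \<partial>lebesgue) * g t \<partial>lebesgue)"
    by (simp add: nn_integral_multc)
  finally show ?thesis .
qed

text \<open>
  The fundamental theorem of calculus without regularity or finiteness assumptions. For
  $I_n(x) = \int_x^\infty F^n g$, Tonelli gives $I_{n+1} + (n+1) I_{n+1} = (n+1) F I_n$, and no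
  subtraction of possibly infinite values occurs.
\<close>

lemma tail_integral_power:
  fixes g :: "real \<Rightarrow> ennreal"
  assumes [measurable]: "g \<in> borel_measurable lebesgue"
  defines "F \<equiv> \<lambda>x. \<integral>\<^sup>+t\<in>{x<..}. g t \<partial>lebesgue"
  shows "of_nat (Suc n) * (\<integral>\<^sup>+t\<in>{x<..}. F t ^ n * g t \<partial>lebesgue) = F x ^ Suc n"
proof (induction n arbitrary: x)
  case 0
  show ?case by (simp add: F_def)
next
  case (Suc n)
  have [measurable]: "F \<in> borel_measurable lebesgue"
    unfolding F_def by measurable
  \<comment> \<open>\<open>q\<close> stands for the derivative of -F^(n+1): by the induction
    hypothesis its tail integral is F^(n+1).\<close>
  define q where "q = (\<lambda>u. of_nat (Suc n) * (F u ^ n * g u))"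
  have [measurable]: "q \<in> borel_measurable lebesgue"
    unfolding q_def by measurable
  have q_tail: "(\<integral>\<^sup>+u\<in>{t<..}. q u \<partial>lebesgue) = F t ^ Suc n" for t
    unfolding q_def Suc.IH[symmetric] by (simp add: nn_integral_cmult[symmetric] mult.assoc)
  \<comment> \<open>The pieces (x,u) and (u,\<infinity>) leave out only the null set {u}.\<close>
  have split: "(\<integral>\<^sup>+t\<in>{..<u}. indicator {x<..} t * g t \<partial>lebesgue) + F u = F x" if "x < u" for u
  proof -
    have "(\<integral>\<^sup>+t\<in>{..<u}. indicator {x<..} t * g t \<partial>lebesgue) + F u =
       (\<integral>\<^sup>+t. indicator {x<..} t * g t * indicator {..<u} t + g t * indicator {u<..} t \<partial>lebesgue)"
      unfolding F_def by (rule nn_integral_add[symmetric]) measurable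
    also have "\<dots> = F x"
      unfolding F_def
    proof (rule nn_integral_cong_AE)
      have "AE t in lebesgue. t \<noteq> u"
        using AE_completion[OF AE_lborel_singleton] .
      then show "AE t in lebesgue. indicator {x<..} t * g t * indicator {..<u} t
          + g t * indicator {u<..} t = g t * indicator {x<..} t"
        by eventually_elim (use that in \<open>auto simp: indicator_def\<close>)
    qed
    finally show ?thesis .
  qed
  have "(\<integral>\<^sup>+t\<in>{x<..}. F t ^ Suc n * g t \<partial>lebesgue) =
      (\<integral>\<^sup>+t. indicator {x<..} t * g t * (\<integral>\<^sup>+u\<in>{t<..}. q u \<partial>lebesgue) \<partial>lebesgue)"
    unfolding q_tail by (simp add: mult_ac)
  also have "\<dots> = (\<integral>\<^sup>+u. (\<integral>\<^sup>+t\<in>{..<u}. indicator {x<..} t * g t \<partial>lebesgue) * q u \<partial>lebesgue)"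
    by (rule Tonelli_tail) measurable
  \<comment> \<open>The extra indicator is harmless because the inner integral is over an empty set
    when u \<le> x; it confines u to the range where \<open>split\<close> applies.\<close>
  also have "\<dots> = (\<integral>\<^sup>+u. (\<integral>\<^sup>+t\<in>{..<u}. indicator {x<..} t * g t \<partial>lebesgue) * q u
      * indicator {x<..} u \<partial>lebesgue)"
  proof (intro nn_integral_cong)
    fix u
    have "(\<integral>\<^sup>+t\<in>{..<u}. indicator {x<..} t * g t \<partial>lebesgue) = (\<integral>\<^sup>+t. 0 \<partial>(lebesgue :: real measure))" if "\<not> x < u"
      by (intro nn_integral_cong) (use that in \<open>auto simp: indicator_def\<close>)
    then show "(\<integral>\<^sup>+t\<in>{..<u}. indicator {x<..} t * g t \<partial>lebesgue) * q u =
       (\<integral>\<^sup>+t\<in>{..<u}. indicator {x<..} t * g t \<partial>lebesgue) * q u * indicator {x<..} u"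
      by (cases "x < u") auto
  qed
  finally have I: "(\<integral>\<^sup>+t\<in>{x<..}. F t ^ Suc n * g t \<partial>lebesgue) = \<dots>" .
  have J: "of_nat (Suc n) * (\<integral>\<^sup>+t\<in>{x<..}. F t ^ Suc n * g t \<partial>lebesgue)
      = (\<integral>\<^sup>+u\<in>{x<..}. F u * q u \<partial>lebesgue)"
    unfolding q_def by (simp add: nn_integral_cmult[symmetric] mult_ac)
  have "of_nat (Suc (Suc n)) * (\<integral>\<^sup>+t\<in>{x<..}. F t ^ Suc n * g t \<partial>lebesgue) =
      (\<integral>\<^sup>+t\<in>{x<..}. F t ^ Suc n * g t \<partial>lebesgue)
      + of_nat (Suc n) * (\<integral>\<^sup>+t\<in>{x<..}. F t ^ Suc n * g t \<partial>lebesgue)"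
    by (subst of_nat_Suc) (simp only: distrib_right mult_1)
  also have "\<dots> = (\<integral>\<^sup>+u. (\<integral>\<^sup>+t\<in>{..<u}. indicator {x<..} t * g t \<partial>lebesgue) * q u
      * indicator {x<..} u + F u * q u * indicator {x<..} u \<partial>lebesgue)"
    \<comment> \<open>The order matters: \<open>J\<close> rewrites the summand carrying the factor
      n+1, and only then may \<open>I\<close> rewrite the remaining copy of the same
      integral.\<close>
    unfolding J unfolding I by (rule nn_integral_add[symmetric]) measurable
  also have "\<dots> = (\<integral>\<^sup>+u. F x * (q u * indicator {x<..} u) \<partial>lebesgue)"
  proof (intro nn_integral_cong)
    fix u
    show "(\<integral>\<^sup>+t\<in>{..<u}. indicator {x<..} t * g t \<partial>lebesgue) * q u * indicator {x<..} u
        + F u * q u * indicator {x<..} u = F x * (q u * indicator {x<..} u)"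
      by (cases "x < u") (simp_all add: split[symmetric] distrib_right)
  qed
  also have "\<dots> = F x ^ Suc (Suc n)"
    by (simp add: nn_integral_cmult q_tail)
  finally show ?case .
qed

section \<open>Hoelder's inequality for two and three factors\<close>

text \<open>Weighted AM-GM bounds the product pointwise by \<alpha> u + \<beta> v, which gives
  integrability; applied to u/U and v/V, with U and V the integrals, it gives the inequality.
  Weights with sum 1 replace conjugate exponents so that the lemma can be iterated.\<close>

lemma Holder_powr:
  fixes u v :: "'a \<Rightarrow> real"
  assumes u: "integrable M u" and v: "integrable M v"
    and u0: "\<And>x. 0 \<le> u x" and v0: "\<And>x. 0 \<le> v x"
    and \<theta>: "0 < \<alpha>" "0 < \<beta>" "\<alpha> + \<beta> = 1"
  shows "integrable M (\<lambda>x. u x powr \<alpha> * v x powr \<beta>)"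
    and "(LINT x|M. u x powr \<alpha> * v x powr \<beta>) \<le> (LINT x|M. u x) powr \<alpha> * (LINT x|M. v x) powr \<beta>"
proof -
  have [measurable]: "u \<in> borel_measurable M" "v \<in> borel_measurable M"
    using u v by auto
  have young: "x powr \<alpha> * y powr \<beta> \<le> \<alpha> * x + \<beta> * y" if "0 \<le> x" "0 \<le> y" for x y :: real
    using Youngs_inequality_0[of \<alpha> \<beta> x y] that \<theta> by (cases "x = 0 \<or> y = 0") auto
  show int: "integrable M (\<lambda>x. u x powr \<alpha> * v x powr \<beta>)"
    by (rule Bochner_Integration.integrable_bound[where f="\<lambda>x. \<alpha> * u x + \<beta> * v x"])
      (use u v \<theta> u0 v0 young in \<open>auto intro!: AE_I2\<close>)
  define U where "U = (LINT x|M. u x)"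
  define V where "V = (LINT x|M. v x)"
  have UV: "0 \<le> U" "0 \<le> V"
    unfolding U_def V_def using u0 v0 by auto
  show "(LINT x|M. u x powr \<alpha> * v x powr \<beta>) \<le> (LINT x|M. u x) powr \<alpha> * (LINT x|M. v x) powr \<beta>"
  \<comment> \<open>Normalising divides by U and V. If one of them is 0, the corresponding function,
    and with it the product, vanishes almost everywhere.\<close>
  proof (cases "U = 0 \<or> V = 0")
    case True
    then have "AE x in M. u x = 0 \<or> v x = 0"
      using integral_nonneg_eq_0_iff_AE[OF u] integral_nonneg_eq_0_iff_AE[OF v] u0 v0
      unfolding U_def V_def by (auto elim: eventually_mono)
    then have "AE x in M. u x powr \<alpha> * v x powr \<beta> = 0"
      by eventually_elim (use \<theta> in auto)
    then have "(LINT x|M. u x powr \<alpha> * v x powr \<beta>) = 0"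
      by (rule integral_eq_zero_AE)
    then show ?thesis by simp
  next
    case False
    with UV have pos: "0 < U" "0 < V" by auto
    have "u x powr \<alpha> * v x powr \<beta> \<le> U powr \<alpha> * V powr \<beta> * (\<alpha> * (u x / U) + \<beta> * (v x / V))" for x
    proof -
      have "u x powr \<alpha> * v x powr \<beta> =
          U powr \<alpha> * V powr \<beta> * ((u x / U) powr \<alpha> * (v x / V) powr \<beta>)"
        using pos u0 v0 by (simp add: powr_divide)
      also have "\<dots> \<le> U powr \<alpha> * V powr \<beta> * (\<alpha> * (u x / U) + \<beta> * (v x / V))"
        using young[of "u x / U" "v x / V"] pos u0 v0 by (intro mult_left_mono) auto
      finally show ?thesis .
    qed
    then have "(LINT x|M. u x powr \<alpha> * v x powr \<beta>)
        \<le> (LINT x|M. U powr \<alpha> * V powr \<beta> * (\<alpha> * (u x / U) + \<beta> * (v x / V)))"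
      using int u v by (intro integral_mono) auto
    also have "\<dots> = U powr \<alpha> * V powr \<beta> * (\<alpha> * (U / U) + \<beta> * (V / V))"
      using u v by (simp add: U_def V_def)
    also have "\<dots> = U powr \<alpha> * V powr \<beta>"
      using pos \<theta> by simp
    finally show ?thesis unfolding U_def V_def .
  qed
qed

text \<open>Two applications of the two-factor case: v and w are merged into \<open>h\<close> with
  the relative weights \<beta>/\<delta> and \<gamma>/\<delta>, so that h^\<delta> = v^\<beta>
  w^\<gamma>, and then u is paired with \<open>h\<close>.\<close>

lemma Holder_powr3:
  fixes u v w :: "'a \<Rightarrow> real"
  assumes u: "integrable M u" and v: "integrable M v" and w: "integrable M w"
    and u0: "\<And>x. 0 \<le> u x" and v0: "\<And>x. 0 \<le> v x" and w0: "\<And>x. 0 \<le> w x"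
    and \<theta>: "0 < \<alpha>" "0 < \<beta>" "0 < \<gamma>" "\<alpha> + \<beta> + \<gamma> = 1"
  shows "integrable M (\<lambda>x. u x powr \<alpha> * v x powr \<beta> * w x powr \<gamma>)"
    and "(LINT x|M. u x powr \<alpha> * v x powr \<beta> * w x powr \<gamma>)
         \<le> (LINT x|M. u x) powr \<alpha> * (LINT x|M. v x) powr \<beta> * (LINT x|M. w x) powr \<gamma>"
proof -
  define \<delta> where "\<delta> = \<beta> + \<gamma>"
  have \<delta>: "0 < \<delta>" "\<alpha> + \<delta> = 1" "\<beta> / \<delta> + \<gamma> / \<delta> = 1"
    using \<theta> by (auto simp: \<delta>_def add_divide_distrib[symmetric])
  have pw: "(x powr (\<beta> / \<delta>) * y powr (\<gamma> / \<delta>)) powr \<delta> = x powr \<beta> * y powr \<gamma>" 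
    if "0 \<le> x" "0 \<le> y" for x y :: real
    using that \<delta> by (simp add: powr_mult powr_powr)
  define h where "h = (\<lambda>x. v x powr (\<beta> / \<delta>) * w x powr (\<gamma> / \<delta>))"
  have vw: "integrable M h" 
    "(LINT x|M. h x) \<le> (LINT x|M. v x) powr (\<beta> / \<delta>) * (LINT x|M. w x) powr (\<gamma> / \<delta>)"
    unfolding h_def using Holder_powr[OF v w v0 w0, of "\<beta> / \<delta>" "\<gamma> / \<delta>"] \<theta> \<delta> by auto
  have h0: "0 \<le> h x" for x by (simp add: h_def)
  have eq: "u x powr \<alpha> * v x powr \<beta> * w x powr \<gamma> = u x powr \<alpha> * h x powr \<delta>" for x
    by (simp add: h_def pw v0 w0)
  show "integrable M (\<lambda>x. u x powr \<alpha> * v x powr \<beta> * w x powr \<gamma>)"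
    unfolding eq using \<theta> \<delta> by (intro Holder_powr u vw u0 h0) auto
  have "(LINT x|M. u x powr \<alpha> * h x powr \<delta>) \<le> (LINT x|M. u x) powr \<alpha> * (LINT x|M. h x) powr \<delta>"
    using \<theta> \<delta> by (intro Holder_powr u vw u0 h0) auto
  also have "\<dots> \<le> (LINT x|M. u x) powr \<alpha> *
      ((LINT x|M. v x) powr (\<beta> / \<delta>) * (LINT x|M. w x) powr (\<gamma> / \<delta>)) powr \<delta>"
    using \<delta> h0 vw by (intro mult_left_mono powr_mono2) auto
  also have "\<dots> = (LINT x|M. u x) powr \<alpha> * (LINT x|M. v x) powr \<beta> * (LINT x|M. w x) powr \<gamma>"
    by (simp add: pw v0 w0)
  finally show "(LINT x|M. u x powr \<alpha> * v x powr \<beta> * w x powr \<gamma>)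
         \<le> (LINT x|M. u x) powr \<alpha> * (LINT x|M. v x) powr \<beta> * (LINT x|M. w x) powr \<gamma>"
    unfolding eq .
qed

text \<open>The case n = 0 stands apart because \<open>0 powr 0 = 0\<close> while
  \<open>0 ^ 0 = 1\<close>.\<close>

lemma power_powr:
  fixes x :: real
  assumes "0 \<le> x"
  shows "(x ^ n) powr c = (if n = 0 then 1 else x powr (real n * c))"
  using assms by (cases "x = 0") (auto simp: powr_realpow[symmetric] powr_powr)

section \<open>Explicit integrals and tail integrals with real values\<close>

text \<open>The primitive -(b-x)^s/s is continuous up to b but is differentiated only where b - x >
  0, hence the interior form of the fundamental theorem. Nonnegativity turns gauge integrability
  into Lebesgue integrability.\<close>

lemma integral_powr_diff:
  fixes a b s :: real
  assumes "a < b" "1 < s"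
  shows "integrable lebesgue (\<lambda>x. indicator {a<..<b} x * (b - x) powr (s - 1))"
    and "(LINT x|lebesgue. indicator {a<..<b} x * (b - x) powr (s - 1)) = (b - a) powr s / s"
proof -
  have "((\<lambda>x. (b - x) powr (s - 1)) has_integral (- ((b - b) powr s / s) - (- ((b - a) powr s / s)))) {a..b}"
  proof (rule fundamental_theorem_of_calculus_interior)
    show "continuous_on {a..b} (\<lambda>x. - ((b - x) powr s / s))"
      using assms by (intro continuous_intros continuous_on_powr') auto
    show "((\<lambda>x. - ((b - x) powr s / s)) has_vector_derivative (b - x) powr (s - 1)) (at x)"
      if "x \<in> {a<..<b}" for x
      unfolding has_real_derivative_iff_has_vector_derivative[symmetric]
      using that assms by (auto intro!: derivative_eq_intros simp: field_simps powr_diff)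
  qed (use assms in auto)
  then have "((\<lambda>x. (b - x) powr (s - 1)) has_integral ((b - a) powr s / s)) {a<..<b}"
    using assms by (simp add: has_integral_Icc_iff_Ioo)
  then have "set_integrable lebesgue {a<..<b} (\<lambda>x. (b - x) powr (s - 1))"
    "(LINT x:{a<..<b}|lebesgue. (b - x) powr (s - 1)) = (b - a) powr s / s"
    by (auto simp: absolutely_integrable_on_iff_nonneg has_integral_iff set_lebesgue_integral_eq_integral(2)
       intro!: nonnegative_absolutely_integrable_1)
  then show "integrable lebesgue (\<lambda>x. indicator {a<..<b} x * (b - x) powr (s - 1))"
    "(LINT x|lebesgue. indicator {a<..<b} x * (b - x) powr (s - 1)) = (b - a) powr s / s"
    by (auto simp: set_integrable_def set_lebesgue_integral_def)
qed


lemma ennreal_tail_integral: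
  fixes g :: "real \<Rightarrow> real"
  assumes g: "integrable lebesgue g" and g0: "\<And>t. 0 \<le> g t"
  shows "(\<integral>\<^sup>+t\<in>{x<..}. ennreal (g t) \<partial>lebesgue) = ennreal (LINT t:{x<..}|lebesgue. g t)"
proof -
  have "integrable lebesgue (\<lambda>t. indicator {x<..} t *\<^sub>R g t)"
    by (rule integrable_mult_indicator[OF _ g]) simp
  then have "(\<integral>\<^sup>+t. ennreal (indicator {x<..} t *\<^sub>R g t) \<partial>lebesgue) = ennreal (LINT t:{x<..}|lebesgue. g t)"
    unfolding set_lebesgue_integral_def by (rule nn_integral_eq_integral) (use g0 in auto)
  moreover have "ennreal (indicator {x<..} t *\<^sub>R g t) = ennreal (g t) * indicator {x<..} t" for t
    by (auto simp: indicator_def)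
  ultimately show ?thesis by simp
qed

lemma tail_integral_nonneg:
  fixes g :: "real \<Rightarrow> real"
  assumes "\<And>t. 0 \<le> g t"
  shows "0 \<le> (LINT t:{x<..}|lebesgue. g t)"
  unfolding set_lebesgue_integral_def using assms by (intro integral_nonneg_AE) auto

text \<open>This is \<open>tail_integral_power\<close> at x = a, where the support condition makes
  the tail the whole integral. Integrability is a conclusion: it follows from the finite value of
  the extended integral.\<close>

lemma tail_integral_power_real:
  fixes g :: "real \<Rightarrow> real"
  assumes g: "integrable lebesgue g" and g0: "\<And>t. 0 \<le> g t"
    and supp: "\<And>t. t \<le> a \<Longrightarrow> g t = 0"
  defines "G \<equiv> \<lambda>x. LINT t:{x<..}|lebesgue. g t"
  shows "integrable lebesgue (\<lambda>t. G t ^ n * g t)"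
    and "(LINT t|lebesgue. G t ^ n * g t) = (LINT t|lebesgue. g t) ^ Suc n / Suc n"
proof -
  have [measurable]: "g \<in> borel_measurable lebesgue" using g by auto
  have G: "(\<integral>\<^sup>+t\<in>{x<..}. ennreal (g t) \<partial>lebesgue) = ennreal (G x)" for x
    unfolding G_def by (rule ennreal_tail_integral[OF g g0])
  have G0: "0 \<le> G x" for x
    unfolding G_def by (rule tail_integral_nonneg[OF g0])
  \<comment> \<open>Measurability of \<open>G\<close> is inherited from the extended tail
    integral.\<close>
  have "G = (\<lambda>x. enn2real (\<integral>\<^sup>+t\<in>{x<..}. ennreal (g t) \<partial>lebesgue))"
    unfolding G using G0 by simp
  also have "\<dots> \<in> borel_measurable lebesgue" by measurable
  finally have [measurable]: "G \<in> borel_measurable lebesgue" .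
  have Ga: "G a = (LINT t|lebesgue. g t)"
    unfolding G_def set_lebesgue_integral_def
    by (intro Bochner_Integration.integral_cong) (auto simp: indicator_def supp)
  define X where "X = (\<integral>\<^sup>+t. ennreal (G t ^ n * g t) \<partial>lebesgue)"
  have "X = (\<integral>\<^sup>+t\<in>{a<..}. ennreal (G t) ^ n * ennreal (g t) \<partial>lebesgue)"
    unfolding X_def
    by (intro nn_integral_cong) (auto simp: indicator_def supp ennreal_mult ennreal_power G0 g0)
  then have *: "of_nat (Suc n) * X = ennreal (G a ^ Suc n)"
    using tail_integral_power[of "\<lambda>t. ennreal (g t)" n a] unfolding G
    by (simp add: ennreal_power ennreal_mult G0)
  have "X = ennreal (G a ^ Suc n / Suc n)"
  proof (cases X)
    case (real x)
    have "ennreal (real (Suc n) * x) = ennreal (G a ^ Suc n)"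
      using * real by (simp add: ennreal_mult ennreal_of_nat_eq_real_of_nat del: of_nat_Suc)
    then have "real (Suc n) * x = G a ^ Suc n"
      using real G0 by (subst (asm) ennreal_inj) (auto simp del: of_nat_Suc)
    then have "x = G a ^ Suc n / Suc n" by (simp add: field_simps)
    then show ?thesis using real by simp
  next
    \<comment> \<open>An infinite \<open>X\<close> would make (n+1) X infinite, but this product
      equals a real number.\<close>
    case top
    then show ?thesis using * by (simp add: ennreal_mult_top del: of_nat_Suc)
  qed
  then have "integrable lebesgue (\<lambda>t. G t ^ n * g t) \<and> 
      (LINT t|lebesgue. G t ^ n * g t) = G a ^ Suc n / Suc n"
    unfolding X_def by (subst (asm) nn_integral_eq_integrable) (use G0 g0 in auto)
  then show "integrable lebesgue (\<lambda>t. G t ^ n * g t)"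
    "(LINT t|lebesgue. G t ^ n * g t) = (LINT t|lebesgue. g t) ^ Suc n / Suc n"
    by (auto simp: Ga)
qed

text \<open>Hoelder for the factors 1 and f on (x,b) with weights 1 - 1/s and 1/s. Only the factor 1
  is cut off at b, which produces b - x; beyond b the function f vanishes anyway.\<close>

lemma tail_integral_Holder:
  fixes f :: "real \<Rightarrow> real"
  assumes fs: "integrable lebesgue (\<lambda>t. f t powr s)" and f0: "\<And>t. 0 \<le> f t"
    and supp: "\<And>t. b \<le> t \<Longrightarrow> f t = 0" and s: "1 < s" and x: "x \<le> b"
  shows "(LINT t:{x<..}|lebesgue. f t) \<le>
    (b - x) powr (1 - 1 / s) * (LINT t:{x<..}|lebesgue. f t powr s) powr (1 / s)"
proof -
  define u :: "real \<Rightarrow> real" where "u = indicator {x<..<b}"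
  define v where "v = (\<lambda>t. indicator {x<..} t * f t powr s)"
  have u: "integrable lebesgue u" "(LINT t|lebesgue. u t) = b - x"
    unfolding u_def using x by (auto simp: measure_def)
  have v: "integrable lebesgue v"
    unfolding v_def using integrable_mult_indicator[OF _ fs, of "{x<..}"] by simp
  have eq: "u t powr (1 - 1 / s) * v t powr (1 / s) = indicator {x<..} t * f t" for t
    using s f0[of t] supp[of t] by (auto simp: u_def v_def indicator_def powr_powr)
  have "(LINT t|lebesgue. u t powr (1 - 1 / s) * v t powr (1 / s))
      \<le> (LINT t|lebesgue. u t) powr (1 - 1 / s) * (LINT t|lebesgue. v t) powr (1 / s)"
    by (rule Holder_powr(2)[OF u(1) v]) (use s in \<open>auto simp: u_def v_def\<close>)
  then show ?thesis
    unfolding eq u by (simp add: v_def set_lebesgue_integral_def)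
qed

theorem theorem2p17:
  fixes a b :: real and r f :: "real \<Rightarrow> real" and p :: nat
  assumes "a < b"
    and "continuous_on {a<..<b} r"
    and "\<And>x. x \<in> {a<..<b} \<Longrightarrow> r x > 0"
    and "p > 1"
    and "set_borel_measurable lebesgue {a<..<b} f"
    and "\<And>x. x \<in> {a<..<b} \<Longrightarrow> f x \<ge> 0"
    and "\<And>x. x \<in> {a<..<b} \<Longrightarrow> set_integrable lebesgue {a<..<x} r"
    and "\<And>x. x \<in> {a<..<b} \<Longrightarrow> set_integrable lebesgue {x<..<b} f"
    and "set_integrable lebesgue {a<..<b} (\<lambda>x. (R_int r a x) ^ p)"
    and "set_integrable lebesgue {a<..<b}
           (\<lambda>x. r x * (LINT t:{x<..<b}|lebesgue. f t) ^ (p + 1))"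
    and "set_integrable lebesgue {a<..<b}
           (\<lambda>x. f x powr (real p * (real p + 1) / (real p - 1)))"
  shows "(LINT x:{a<..<b}|lebesgue. r x * (LINT t:{x<..<b}|lebesgue. f t) ^ (p + 1))
         \<le> C_const p r a b *
           (LINT x:{a<..<b}|lebesgue. f x powr (real p * (real p + 1) / (real p - 1)))
             powr ((real p - 1) / real p)"
proof -

  \<comment> \<open>Extension by zero and arithmetic of the exponents\<close>
  define I where "I = {a<..<b}"
  define s where "s = real p * (real p + 1) / (real p - 1)"
  \<comment> \<open>Extension by zero lets all integrals run over the whole line or over tails, as
    in the lemmas above.\<close>
  define ff where "ff = (\<lambda>x. indicator I x * f x)"
  define gg where "gg = (\<lambda>x. ff x powr s)"
  define F where "F = (\<lambda>x. LINT t:{x<..}|lebesgue. ff t)"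
  define G where "G = (\<lambda>x. LINT t:{x<..}|lebesgue. gg t)"
  define rr where "rr = (\<lambda>x. indicator I x * r x)"
  \<comment> \<open>The cut-off is needed for \<open>R\<close> to be nonnegative everywhere: beyond
    b, the sign of r is not controlled.\<close>
  define R where "R = (\<lambda>x. indicator I x * R_int r a x)"
  note ab = \<open>a < b\<close> and p = \<open>p > 1\<close>
  have s_alt: "s = (real p + 1) * (real p / (real p - 1))"
    by (simp add: s_def)
  have "1 \<le> real p / (real p - 1)" using p by (simp add: field_simps)
  then have "(real p + 1) * 1 \<le> s" unfolding s_alt by (intro mult_left_mono) auto
  then have s_ge: "real p + 1 \<le> s" by simp
  then have s: "1 < s" using p by auto
  \<comment> \<open>In order: the three Hoelder weights add up to 1; the exponent of b - x in the
    bound for F^p fits the second factor; (b-a)^s becomes (b-a)^p; and the (p+1)-st power of the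
    integral of f^s receives the exponent (p-1)/p.\<close>
  have weights: "1 / real p + real p / s + 1 / s = 1" "(s - 1) * (real p / s) = (1 - 1 / s) * real p"
    "s * (real p / s) = real p" "(real p + 1) / s = (real p - 1) / real p"
  proof -
    define k where "k = real p"
    have k: "k \<noteq> 0" "k - 1 \<noteq> 0" "k + 1 \<noteq> 0" using p by (auto simp: k_def)
    have "1 / s = (k - 1) / (k * (k + 1))" "k / s = (k - 1) / (k + 1)"
      using k(1) by (simp_all add: s_def k_def)
    note inv = this
    have "1 / k + k / s + 1 / s = 1"
      unfolding inv using k by (simp add: divide_simps) (simp add: algebra_simps)
    then show "1 / real p + real p / s + 1 / s = 1" by (simp add: k_def)
    have "(k + 1) * (1 / s) = (k - 1) / k"
      unfolding inv using k by simp
    then show "(real p + 1) / s = (real p - 1) / real p" by (simp add: k_def)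
    show "(s - 1) * (real p / s) = (1 - 1 / s) * real p" "s * (real p / s) = real p"
      using s by (simp_all add: field_simps)
  qed

  \<comment> \<open>Signs, measurability and integrability of the extended functions\<close>
  have ff0: "0 \<le> ff x" for x
    using assms(6) by (auto simp: ff_def I_def indicator_def)
  have gg0: "0 \<le> gg x" for x by (simp add: gg_def)
  have rr0: "0 \<le> rr x" for x
    using assms(3)[of x] by (auto simp: rr_def I_def indicator_def)
  have supp: "ff x = 0" "gg x = 0" if "x \<notin> I" for x
    using that by (auto simp: ff_def gg_def)
  have gg_eq: "gg x = indicator I x * f x powr s" for x
    by (auto simp: gg_def ff_def indicator_def)

  have ff_meas [measurable]: "ff \<in> borel_measurable lebesgue"
    using assms(5) by (simp add: set_borel_measurable_def ff_def I_def)
  have gg: "integrable lebesgue gg"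
    using assms(11) unfolding set_integrable_def gg_eq s_def I_def by simp
  \<comment> \<open>On the bounded interval f \<le> 1 + f^s, because s > 1, so integrability of f^s
    passes to f.\<close>
  have ff: "integrable lebesgue ff"
  proof (rule Bochner_Integration.integrable_bound)
    show "integrable lebesgue (\<lambda>x. indicator I x + gg x)"
      unfolding I_def using gg ab
      by (intro Bochner_Integration.integrable_add integrable_real_indicator) auto
    have "\<bar>ff x\<bar> \<le> indicator I x + gg x" for x
    proof (cases "1 \<le> ff x")
      case True
      then have "ff x powr 1 \<le> ff x powr s" using s by (intro powr_mono) auto
      then show ?thesis using True by (simp add: gg_def indicator_def)
    next
      case False
      then show ?thesis using ff0[of x] gg0[of x] supp[of x] by (cases "x \<in> I") auto
    qed
    then show "AE x in lebesgue. norm (ff x) \<le> norm (indicator I x + gg x)"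
      using gg0 by (intro AE_I2) (smt (verit) real_norm_def)
  qed fact
  have rr_meas [measurable]: "rr \<in> borel_measurable lebesgue"
  proof -
    have "(\<lambda>x. indicator I x *\<^sub>R r x) \<in> borel_measurable borel"
      unfolding I_def using assms(2) by (intro borel_measurable_continuous_on_indicator) auto
    then show ?thesis
      unfolding rr_def by (intro measurable_completion) simp
  qed
  have F0: "0 \<le> F x" and G0: "0 \<le> G x" for x
    unfolding F_def G_def by (intro tail_integral_nonneg ff0 gg0)+
  have F_enn: "(\<integral>\<^sup>+t\<in>{x<..}. ennreal (ff t) \<partial>lebesgue) = ennreal (F x)" for x
    unfolding F_def by (rule ennreal_tail_integral[OF ff ff0])
  have F_eq: "(LINT t:{x<..<b}|lebesgue. f t) = F x" if "x \<in> I" for x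
    unfolding F_def set_lebesgue_integral_def using that
    by (intro Bochner_Integration.integral_cong) (auto simp: I_def ff_def indicator_def)

  have R_int0: "0 \<le> R_int r a x" if "x \<in> I" for x
    unfolding R_int_def set_lebesgue_integral_def using that assms(3)
    by (intro integral_nonneg_AE AE_I2) (force simp: I_def indicator_def)
  then have R0: "0 \<le> R x" for x
    by (auto simp: R_def indicator_def)
  \<comment> \<open>The point t must lie in \<open>I\<close>, since r is known to be integrable only
    on (a,t) with t < b.\<close>
  have R_enn: "(\<integral>\<^sup>+x\<in>{..<t}. ennreal (rr x) \<partial>lebesgue) = ennreal (R t)" if t: "t \<in> I" for t
  proof -
    have "(\<integral>\<^sup>+x\<in>{..<t}. ennreal (rr x) \<partial>lebesgue) = 
        (\<integral>\<^sup>+x. ennreal (indicator {a<..<t} x *\<^sub>R r x) \<partial>lebesgue)"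
      using t by (intro nn_integral_cong) (auto simp: rr_def I_def indicator_def)
    also have "\<dots> = ennreal (R_int r a t)"
      unfolding R_int_def set_lebesgue_integral_def
    proof (rule nn_integral_eq_integral)
      show "integrable lebesgue (\<lambda>x. indicator {a<..<t} x *\<^sub>R r x)"
        using assms(7)[of t] t by (simp add: set_integrable_def I_def)
      have "0 \<le> indicator {a<..<t} x *\<^sub>R r x" for x
        using assms(3)[of x] t by (auto simp: I_def indicator_def)
      then show "AE x in lebesgue. 0 \<le> indicator {a<..<t} x *\<^sub>R r x" by simp
    qed
    finally show ?thesis using t by (simp add: R_def)
  qed

  \<comment> \<open>The three Hoelder factors and the pointwise bound\<close>
  define u where "u = (\<lambda>x. R x ^ p)"
  define v where "v = (\<lambda>x. indicator I x * (b - x) powr (s - 1))"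
  define w where "w = (\<lambda>x. G x ^ p * gg x)"
  have u_eq: "u x = indicator I x * R_int r a x ^ p" for x
    using p by (auto simp: u_def R_def indicator_def)
  have u: "integrable lebesgue u"
    and v: "integrable lebesgue v" "(LINT x|lebesgue. v x) = (b - a) powr s / s"
    and w: "integrable lebesgue w" 
      "(LINT x|lebesgue. w x) = (LINT x|lebesgue. gg x) ^ Suc p / Suc p"
    using assms(9) integral_powr_diff[OF ab s]
      tail_integral_power_real[OF gg gg0 supp(2), of a p]
    unfolding u_eq v_def w_def set_integrable_def I_def G_def by auto
  have uvw0: "0 \<le> u x" "0 \<le> v x" "0 \<le> w x" for x
    by (auto simp: u_def v_def w_def R0 G0 gg0)
  define K where "K = (\<lambda>x. u x powr (1 / p) * v x powr (p / s) * w x powr (1 / s))"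
  note K = Holder_powr3[OF u v(1) w(1) uvw0, of "1 / p" "p / s" "1 / s", folded K_def]
  have K_int: "integrable lebesgue K"
    using K(1) weights p s by (simp add: K_def)
  have K_le: "(LINT x|lebesgue. K x) \<le> (LINT x|lebesgue. u x) powr (1 / p) *
      (LINT x|lebesgue. v x) powr (p / s) * (LINT x|lebesgue. w x) powr (1 / s)"
    using K(2) weights p s by (simp add: K_def)
  \<comment> \<open>\<open>tail_integral_Holder\<close> raised to the power p bounds F^p by
    (b-x)^((1-1/s)p) (G^p)^(1/s). The remaining f equals (f^s)^(1/s) and joins G^p inside
    \<open>w\<close>.\<close>
  have K_ge: "R x * (F x ^ p * ff x) \<le> K x" if x: "x \<in> I" for x
  proof -
    have "F x \<le> (b - x) powr (1 - 1 / s) * G x powr (1 / s)"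
      unfolding F_def G_def gg_def
      by (rule tail_integral_Holder)
        (use gg ff0 supp(1) s x in \<open>auto simp: gg_def[symmetric] I_def\<close>)
    then have "F x ^ p \<le> ((b - x) powr (1 - 1 / s) * G x powr (1 / s)) ^ p"
      using F0 by (intro power_mono) auto
    also have "\<dots> = v x powr (p / s) * (G x ^ p) powr (1 / s)"
    proof -
      have "v x powr (p / s) = (b - x) powr ((1 - 1 / s) * real p)"
        using x weights(2) by (simp add: v_def powr_powr)
      moreover have "(y powr c) ^ p = y powr (c * real p)" for y c :: real
        \<comment> \<open>The exponent 1 in \<open>power_powr\<close> turns the natural power into a
          real one.\<close>
        using p power_powr[of "y powr c" p 1] by (simp add: powr_powr)
      ultimately show ?thesis
        using p G0 by (simp add: power_mult_distrib power_powr)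
    qed
    finally have "R x * (F x ^ p * ff x)
        \<le> R x * (v x powr (p / s) * (G x ^ p) powr (1 / s) * ff x)"
      using R0 ff0 by (intro mult_left_mono mult_right_mono) auto
    also have "\<dots> = K x"
    proof -
      have "u x powr (1 / p) = R x" "w x powr (1 / s) = (G x ^ p) powr (1 / s) * ff x"
        using p s R0 ff0 G0 by (simp_all add: u_def w_def gg_def power_powr powr_mult powr_powr)
      then show ?thesis by (simp add: K_def)
    qed
    finally show ?thesis .
  qed

  \<comment> \<open>Tonelli on the left-hand side\<close>
  \<comment> \<open>The factor p+1 makes F^(p+1) the tail integral of \<open>q\<close>, so Tonelli
    moves the integration onto r and produces R.\<close>
  define q where "q = (\<lambda>t. of_nat (Suc p) * (ennreal (F t) ^ p * ennreal (ff t)))"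
  have q_meas [measurable]: "q \<in> borel_measurable lebesgue"
    unfolding q_def F_enn[symmetric] by measurable
  have q_tail: "(\<integral>\<^sup>+t\<in>{x<..}. q t \<partial>lebesgue) = ennreal (F x) ^ Suc p" for x
    using tail_integral_power[of "\<lambda>t. ennreal (ff t)" p x]
    by (simp add: q_def F_enn[symmetric] nn_integral_cmult[symmetric] mult.assoc)
  define L where "L = (LINT x:{a<..<b}|lebesgue. r x * (LINT t:{x<..<b}|lebesgue. f t) ^ (p + 1))"
  have L_integrand: "indicator {a<..<b} x *\<^sub>R (r x * (LINT t:{x<..<b}|lebesgue. f t) ^ (p + 1))
      = rr x * F x ^ Suc p" for x
    by (cases "x \<in> I") (auto simp: rr_def F_eq I_def)
  have L_int: "integrable lebesgue (\<lambda>x. rr x * F x ^ Suc p)"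
    using assms(10) unfolding set_integrable_def L_integrand .
  have L_eq: "L = (LINT x|lebesgue. rr x * F x ^ Suc p)"
    unfolding L_def by (subst set_lebesgue_integral_def) (simp only: L_integrand)
  have "ennreal L = (\<integral>\<^sup>+x. ennreal (rr x * F x ^ Suc p) \<partial>lebesgue)"
    unfolding L_eq
    by (intro nn_integral_eq_integral[symmetric] L_int AE_I2 mult_nonneg_nonneg rr0 zero_le_power F0)
  also have "\<dots> = (\<integral>\<^sup>+x. ennreal (rr x) * (\<integral>\<^sup>+t\<in>{x<..}. q t \<partial>lebesgue) \<partial>lebesgue)"
    unfolding q_tail by (simp only: ennreal_mult[OF rr0 zero_le_power[OF F0]] ennreal_power F0)
  also have "\<dots> = (\<integral>\<^sup>+t. (\<integral>\<^sup>+x\<in>{..<t}. ennreal (rr x) \<partial>lebesgue) * q t \<partial>lebesgue)"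
    by (rule Tonelli_tail) measurable
  \<comment> \<open>The comparison with \<open>K\<close> takes place among extended integrals:
    integrability of \<open>K\<close> then gives a finite bound, and one can return to the reals.
    Off \<open>I\<close> the left integrand is 0 because \<open>q\<close> is.\<close>
  also have "\<dots> \<le> (\<integral>\<^sup>+t. ennreal (Suc p * K t) \<partial>lebesgue)"
  proof (intro nn_integral_mono)
    fix t
    show "(\<integral>\<^sup>+x\<in>{..<t}. ennreal (rr x) \<partial>lebesgue) * q t \<le> ennreal (Suc p * K t)"
    proof (cases "t \<in> I")
      case True
      have "(\<integral>\<^sup>+x\<in>{..<t}. ennreal (rr x) \<partial>lebesgue) * q t = 
          ennreal (Suc p * (R t * (F t ^ p * ff t)))"
        unfolding R_enn[OF True] q_def
        by (simp add: ennreal_mult ennreal_power F0 ff0 R0 ennreal_of_nat_eq_real_of_nat mult_ac del: of_nat_Suc)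
      also have "\<dots> \<le> ennreal (Suc p * K t)"
        by (intro ennreal_leI mult_left_mono K_ge True) auto
      finally show ?thesis .
    qed (simp add: q_def supp)
  qed
  also have "\<dots> = ennreal (Suc p * (LINT x|lebesgue. K x))"
    using K_int by (subst nn_integral_eq_integral) (auto simp: K_def)
  finally have "L \<le> Suc p * (LINT x|lebesgue. K x)"
    by (subst (asm) ennreal_le_iff) (auto simp: K_def)
  also have "\<dots> \<le> Suc p * ((LINT x|lebesgue. u x) powr (1 / p) *
      (LINT x|lebesgue. v x) powr (p / s) * (LINT x|lebesgue. w x) powr (1 / s))"
    by (intro mult_left_mono K_le) auto

  \<comment> \<open>Comparison of the constants\<close>
  also have "\<dots> \<le> C_const p r a b * (LINT x|lebesgue. gg x) powr ((real p - 1) / real p)"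
  proof -
    define J where "J = (LINT x|lebesgue. gg x)"
    define P where "P = real p + 1"
    have J0: "0 \<le> J" unfolding J_def using gg0 by simp
    have P: "0 < P" "P \<le> s" using s_ge by (auto simp: P_def)
    have C: "C_const p r a b = P powr (1 / p) * (b - a) ^ p * (LINT x|lebesgue. u x) powr (1 / p)"
      unfolding C_const_def set_lebesgue_integral_def u_eq I_def P_def by simp
    have V: "(LINT x|lebesgue. v x) powr (p / s) = (b - a) ^ p / s powr (p / s)"
      unfolding v using ab s weights(3) by (simp add: powr_divide powr_powr powr_realpow)
    have W: "(LINT x|lebesgue. w x) powr (1 / s) = J powr ((real p - 1) / p) / P powr (1 / s)"
      unfolding w J_def[symmetric] weights(4)[symmetric] using J0 P
      by (simp add: powr_divide power_powr P_def add_ac del: power_Suc)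
    \<comment> \<open>Splitting p+1 along the three weights: P^(1/s) cancels the denominator from
      \<open>W\<close>, P^(p/s) \<le> s^(p/s) absorbs the one from \<open>V\<close>, and P^(1/p) is
      the factor in C.\<close>
    have "P = P powr (1 / p + p / s + 1 / s)"
      using weights(1) P by simp
    also have "\<dots> = P powr (1 / p) * P powr (p / s) * P powr (1 / s)"
      by (simp add: powr_add)
    also have "\<dots> \<le> P powr (1 / p) * s powr (p / s) * P powr (1 / s)"
      using P by (intro mult_left_mono mult_right_mono powr_mono2) auto
    finally have "P / (s powr (p / s) * P powr (1 / s)) \<le> P powr (1 / p)"
      using P s by (simp add: field_simps)
    then have "P / (s powr (p / s) * P powr (1 / s)) *
        ((LINT x|lebesgue. u x) powr (1 / p) * (b - a) ^ p * J powr ((real p - 1) / p)) \<le>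
        P powr (1 / p) *
        ((LINT x|lebesgue. u x) powr (1 / p) * (b - a) ^ p * J powr ((real p - 1) / p))"
      using ab by (intro mult_right_mono) auto
    then show ?thesis
      unfolding C V W J_def[symmetric] by (simp add: P_def mult_ac add_ac)
  qed
  finally have "L \<le> \<dots>" .
  moreover have "(LINT x|lebesgue. gg x) = (LINT x:{a<..<b}|lebesgue. f x powr s)"
    by (simp add: set_lebesgue_integral_def gg_eq I_def)
  ultimately show ?thesis
    unfolding L_def s_def by simp
qed

end
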